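(* Let $K$ be a commutative semihypergroup. Then there exists a left invariant mean on $C(K)$.
   Context: All topologies are Hausdorff. For a locally compact Hausdorff space $X$: $M(X)$ is the space of regular complex Borel measures on $X$; $M^+(X)$ is the set of finite non-negative regular Borel measures, with the cone topology (the weakest topology making $\mu\mapsto\int_X f\,d\mu$ continuous for every $f\in C_c^+(X)\cup\{1_X\}$, where $C_c^+(X)$ is the set of non-negative compactly supported continuous functions and $1_X$ is the constant function $1$); $\mathfrak{C}(X)$ is the set of compact subsets of $X$ with the Michael topology, generated by the sub-basis of sets $\{C\in\mathfrak{C}(X): C\cap U\neq\emptyset,\ C\subset V\}$ for $U,V$ open in $X$; $p_x$ is the point mass at $x$. A semihypergroup is a pair $(K,* )$ such that: (A1) $K$ is a locally compact Hausdorff space and $*$ is a binary operation making $M(K)$ an associative algebra; (A2) the bilinear map $*$ sends $M^+(K)\times M^+(K)$ into $M^+(K)$ and its restriction to $M^+(K)\times M^+(K)$ is (jointly) continuous; (A3) for all $x,y\in K$, $p_x*p_y$ is a probability measure with compact support; (A4) the map $(x,y)\mapsto \mathrm{supp}(p_x*p_y)$, $K\times K\to\mathfrak{C}(K)$, is continuous. It is commutative if $\mu*\nu=\nu*\mu$ for all $\mu,\nu\in M(K)$ (equivalently $p_x*p_y=p_y*p_x$ for all $x,y\in K$). $C(K)$ is the space of bounded continuous complex-valued functions on $K$ with the supremum norm. For $f\in C(K)$ and $x,y\in K$, $L_xf(y)=f(x*y):=\int_K f\,d(p_x*p_y)$. A mean on $C(K)$ is $m\in C(K)^*$ with $\|m\|=1=m(1)$;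 it is a left invariant mean if $m(L_xf)=m(f)$ for all $x\in K$, $f\in C(K)$. *)

theory Defs
  imports "HOL-Analysis.Analysis"
begin

section \<open>Regular complex Borel measures\<close>

text \<open>
  A complex Borel measure is a complex-valued set function. Only its values on Borel sets
  matter; they are fixed to be 0 elsewhere so that equality of measures is equality of functions.
\<close>

type_synonym 'a set_function = "'a set \<Rightarrow> complex"

definition complex_borel_measure :: "'a::topological_space set_function \<Rightarrow> bool" where
  "complex_borel_measure \<mu> \<longleftrightarrow>
     (\<forall>A :: nat \<Rightarrow> 'a set. range A \<subseteq> sets borel \<longrightarrow> disjoint_family A \<longrightarrow>
        (\<lambda>i. \<mu> (A i)) sums \<mu> (\<Union>i. A i)) \<and>
     (\<forall>E. E \<notin> sets borel \<longrightarrow> \<mu> E = 0)"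

definition total_variation :: "'a::topological_space set_function \<Rightarrow> 'a set \<Rightarrow> ennreal" where
  "total_variation \<mu> E =
     (SUP A \<in> {A :: nat \<Rightarrow> 'a set. range A \<subseteq> sets borel \<and> disjoint_family A \<and> (\<Union>i. A i) = E}.
        \<Sum>i. ennreal (norm (\<mu> (A i))))"

definition regular_measure :: "'a::topological_space set_function \<Rightarrow> bool" where
  "regular_measure \<mu> \<longleftrightarrow>
     (\<forall>E \<in> sets borel. \<forall>\<epsilon>>0. \<exists>C U. compact C \<and> open U \<and> C \<subseteq> E \<and> E \<subseteq> U \<and>
        total_variation \<mu> (U - C) < ennreal \<epsilon>)"

definition M_space :: "'a::topological_space set_function set" where
  "M_space = {\<mu>. complex_borel_measure \<mu> \<and> regular_measure \<mu>}"

definition M_pos :: "'a::topological_space set_function set" where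
  "M_pos = {\<mu> \<in> M_space. \<forall>E. \<mu> E \<in> \<real>\<^sub>\<ge>\<^sub>0}"

definition msupp :: "'a::topological_space set_function \<Rightarrow> 'a set" where
  "msupp \<mu> = {x. \<forall>U. open U \<longrightarrow> x \<in> U \<longrightarrow> total_variation \<mu> U \<noteq> 0}"

definition point_mass :: "'a::topological_space \<Rightarrow> 'a set_function" where
  "point_mass x = (\<lambda>E. of_bool (E \<in> sets borel \<and> x \<in> E))"

text \<open>
  The library measure belonging to an element of \<^const>\<open>M_pos\<close> (it is only used for those), giving
  access to the Bochner integral.
\<close>

definition to_measure :: "'a::topological_space set_function \<Rightarrow> 'a measure" where
  "to_measure \<mu> = measure_of UNIV (sets borel) (\<lambda>E. ennreal (Re (\<mu> E)))"


section \<open>The cone topology and the Michael topology\<close>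

definition Cc_pos :: "('a::topological_space \<Rightarrow> real) set" where
  "Cc_pos = {f. continuous_on UNIV f \<and> (\<forall>x. 0 \<le> f x) \<and> compact (closure {x. f x \<noteq> 0})}"

definition cone_topology :: "'a::topological_space set_function topology" where
  "cone_topology = topology_generated_by
     {{\<mu> \<in> M_pos. integral\<^sup>L (to_measure \<mu>) f \<in> V} | f V. f \<in> Cc_pos \<union> {\<lambda>x. 1} \<and> open V}"

text \<open>
  \<^const>\<open>topology_generated_by\<close> takes the union of the sub-basis as the underlying set. The
  empty set lies in no set of the Michael sub-basis, so the whole space is added explicitly.
\<close>

definition michael_topology :: "'a::topological_space set topology" where
  "michael_topology = topology_generated_by
     (insert {C. compact C}
       {{C. compact C \<and> C \<inter> U \<noteq> {} \<and> C \<subseteq> V} | U V. open U \<and> open V})"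


section \<open>Semihypergroups\<close>

text \<open>
  The operation is a total function on set functions, but it is only constrained on
  \<^const>\<open>M_space\<close>, and only its values there are ever used.
\<close>

locale semihypergroup =
  fixes conv :: "'a::t2_space set_function \<Rightarrow> 'a set_function \<Rightarrow> 'a set_function"
  assumes locally_compact: "locally_compact_space (euclidean :: 'a topology)"
    and conv_closed: "\<lbrakk>\<mu> \<in> M_space; \<nu> \<in> M_space\<rbrakk> \<Longrightarrow> conv \<mu> \<nu> \<in> M_space"
    and conv_assoc: "\<lbrakk>\<mu> \<in> M_space; \<nu> \<in> M_space; \<rho> \<in> M_space\<rbrakk>
      \<Longrightarrow> conv (conv \<mu> \<nu>) \<rho> = conv \<mu> (conv \<nu> \<rho>)"
    and conv_linear_left: "\<lbrakk>\<mu> \<in> M_space; \<nu> \<in> M_space; \<rho> \<in> M_space\<rbrakk>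
      \<Longrightarrow> conv (\<lambda>E. a * \<mu> E + b * \<nu> E) \<rho> = (\<lambda>E. a * conv \<mu> \<rho> E + b * conv \<nu> \<rho> E)"
    and conv_linear_right: "\<lbrakk>\<mu> \<in> M_space; \<nu> \<in> M_space; \<rho> \<in> M_space\<rbrakk>
      \<Longrightarrow> conv \<rho> (\<lambda>E. a * \<mu> E + b * \<nu> E) = (\<lambda>E. a * conv \<rho> \<mu> E + b * conv \<rho> \<nu> E)"
    and conv_pos: "\<lbrakk>\<mu> \<in> M_pos; \<nu> \<in> M_pos\<rbrakk> \<Longrightarrow> conv \<mu> \<nu> \<in> M_pos"
    and conv_continuous:
      "continuous_map (prod_topology cone_topology cone_topology) cone_topology
         (\<lambda>(\<mu>, \<nu>). conv \<mu> \<nu>)"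
    and conv_point_mass_prob:
      "conv (point_mass x) (point_mass y) \<in> M_pos" "conv (point_mass x) (point_mass y) UNIV = 1"
    and conv_point_mass_compact: "compact (msupp (conv (point_mass x) (point_mass y)))"
    and msupp_continuous:
      "continuous_map (prod_topology euclidean euclidean) michael_topology
         (\<lambda>(x, y). msupp (conv (point_mass x) (point_mass y)))"

locale commutative_semihypergroup = semihypergroup +
  assumes conv_commute: "\<lbrakk>\<mu> \<in> M_space; \<nu> \<in> M_space\<rbrakk> \<Longrightarrow> conv \<mu> \<nu> = conv \<nu> \<mu>"


section \<open>Invariant means\<close>

definition left_translate ::
  "('a::t2_space set_function \<Rightarrow> 'a set_function \<Rightarrow> 'a set_function) \<Rightarrow>
   'a \<Rightarrow> ('a \<Rightarrow> complex) \<Rightarrow> 'a \<Rightarrow> complex" where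
  "left_translate conv x f y =
     integral\<^sup>L (to_measure (conv (point_mass x) (point_mass y))) f"

text \<open>The library only provides the real scalar multiplication on bounded continuous functions.\<close>

definition scaleC_bcontfun ::
  "complex \<Rightarrow> ('a::topological_space \<Rightarrow>\<^sub>C complex) \<Rightarrow> ('a \<Rightarrow>\<^sub>C complex)" where
  "scaleC_bcontfun c f = Bcontfun (\<lambda>x. c * apply_bcontfun f x)"

lemma apply_scaleC_bcontfun [simp]:
  "apply_bcontfun (scaleC_bcontfun c f) x = c * apply_bcontfun f x"
proof -
  have "apply_bcontfun f \<in> bcontfun"
    by (rule apply_bcontfun)
  then have cont: "continuous_on UNIV (apply_bcontfun f)" and "bounded (range (apply_bcontfun f))"
    by (auto simp: bcontfun_def)
  then have "bounded ((*) c ` range (apply_bcontfun f))"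
    by (intro bounded_linear_image bounded_linear_mult_right)
  then have "bounded (range (\<lambda>x. c * apply_bcontfun f x))"
    by (simp add: image_image)
  with cont have "(\<lambda>x. c * apply_bcontfun f x) \<in> bcontfun"
    by (auto simp: bcontfun_def intro: continuous_on_mult_left)
  then show ?thesis
    by (simp add: scaleC_bcontfun_def Bcontfun_inverse)
qed

text \<open>
  For a complex-linear functional \<^const>\<open>onorm\<close>, the supremum of \<open>norm (m f) / norm f\<close>,
  is the norm in the complex dual space.
\<close>

definition is_mean :: "(('a::topological_space \<Rightarrow>\<^sub>C complex) \<Rightarrow> complex) \<Rightarrow> bool" where
  "is_mean m \<longleftrightarrow> bounded_linear m \<and> (\<forall>c f. m (scaleC_bcontfun c f) = c * m f) \<and>
     onorm m = 1 \<and> m (const_bcontfun 1) = 1"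

text \<open>
  In a semihypergroup translates of bounded continuous functions are bounded and continuous.
  Membership in \<^const>\<open>bcontfun\<close> is nevertheless demanded here, so that \<^const>\<open>Bcontfun\<close>
  is never applied outside its domain.
\<close>

definition left_invariant_mean ::
  "('a::t2_space set_function \<Rightarrow> 'a set_function \<Rightarrow> 'a set_function) \<Rightarrow>
   (('a \<Rightarrow>\<^sub>C complex) \<Rightarrow> complex) \<Rightarrow> bool" where
  "left_invariant_mean conv m \<longleftrightarrow> is_mean m \<and>
     (\<forall>x f. left_translate conv x (apply_bcontfun f) \<in> bcontfun \<and>
        m (Bcontfun (left_translate conv x (apply_bcontfun f))) = m f)"

end

theory Submission
  imports Defs
begin

text \<open>
  Write \<open>L x\<close> for the translation by \<open>x\<close>, acting on the space \<open>C\<close> of bounded continuous functions.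
  The theorem holds because the operators \<open>L x\<close> form a commuting family of linear contractions of
  \<open>C\<close> that fix the constant \<open>1\<close>. Precomposition with \<open>L x\<close> therefore maps the set of means into
  itself; this set is convex and compact in the topology of pointwise convergence, so
  the Markov-Kakutani argument yields a mean fixed by all these maps.

  Two analytic facts are hidden in this sketch: that \<open>L x f\<close> is again continuous, and that \<open>L x\<close>
  and \<open>L y\<close> commute. Both depend on the cone topology, which by definition only controls
  integrals of compactly supported functions and the total mass.

  \<^item> A single regular measure is concentrated on a compact set up to \<open>\<epsilon>\<close>. Since the total mass and
    the integral of a compactly supported cutoff are both controlled near that measure,
    all nearby measures are concentrated on a common compact set up to \<open>\<epsilon>\<close>. Hence integration of any
    bounded continuous function is continuous in the measure (\<open>continuous_map_integral\<close>). Composed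
    with the continuity of the convolution this makes \<open>L x f\<close> continuous.
  \<^item> Commutation rests on the formula that the integral of \<open>f\<close> against \<open>p\<^sub>y * \<mu>\<close> equals the integral
    of \<open>L y f\<close> against \<open>\<mu>\<close> (\<open>integral_conv_real\<close>). It is clear from linearity if \<open>\<mu>\<close> is a finite
    combination of point masses; both sides are continuous in \<open>\<mu>\<close>, and such combinations are dense
    in the cone topology because integrals are limits of Riemann sums (\<open>atomic_dense\<close>). By this
    formula \<open>L x (L y f)\<close> at \<open>z\<close> is the integral of \<open>f\<close> against \<open>p\<^sub>y * (p\<^sub>x * p\<^sub>z)\<close>, and
    associativity with commutativity makes this symmetric in \<open>x\<close> and \<open>y\<close>.

  The fixed point is found as follows. Averaging a mean over the first \<open>n\<close> powers of \<open>L x\<close>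
  makes it invariant under \<open>L x\<close> up to \<open>2 * norm f / n\<close>. Since the operators commute, averaging over
  one of them does not spoil the approximate invariance already gained for the others
  (\<open>approximately_invariant_functional\<close>); Tychonoff's theorem turns approximate
  invariance under finitely many translations into exact invariance under all of them
  (\<open>Markov_Kakutani_functionals\<close>).
\<close>

section \<open>Positive regular measures as library measures\<close>

lemma first_term_le_suminf: "f (0::nat) \<le> (\<Sum>i. f i)" for f :: "nat \<Rightarrow> ennreal"
  using sum_le_suminf[OF summableI, of "{0}" f] by simp

text \<open>
  Evaluated on the partition of \<open>E\<close> whose only nonempty piece is \<open>E\<close> itself. This is how regularity,
  which is phrased by the total variation, becomes a statement about the measure.
\<close>

lemma norm_le_total_variation:
  assumes "E \<in> sets borel"
  shows "ennreal (norm (\<mu> E)) \<le> total_variation \<mu> E"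
proof -
  define A where "A = (\<lambda>i::nat. if i = 0 then E else {})"
  have "ennreal (norm (\<mu> E)) = ennreal (norm (\<mu> (A 0)))"
    by (simp add: A_def)
  also have "\<dots> \<le> (\<Sum>i. ennreal (norm (\<mu> (A i))))"
    by (rule first_term_le_suminf)
  also have "\<dots> \<le> total_variation \<mu> E"
    unfolding total_variation_def
    by (rule SUP_upper) (use assms in \<open>auto simp: A_def disjoint_family_on_def split: if_splits\<close>)
  finally show ?thesis .
qed

lemma sets_to_measure [simp, measurable_cong]: "sets (to_measure \<mu>) = sets borel"
  using sets.sigma_sets_eq[of "borel :: 'a measure"] by (simp add: to_measure_def)

lemma space_to_measure [simp]: "space (to_measure \<mu>) = UNIV"
  by (simp add: to_measure_def)

lemma M_posD:
  assumes "\<mu> \<in> M_pos"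
  shows "Re (\<mu> E) \<ge> 0" "Im (\<mu> E) = 0" "\<mu> \<in> M_space"
  using assms by (auto simp: M_pos_def complex_nonneg_Reals_iff)

lemma emeasure_to_measure:
  assumes "\<mu> \<in> M_pos" "E \<in> sets borel"
  shows "emeasure (to_measure \<mu>) E = ennreal (Re (\<mu> E))"
  unfolding to_measure_def
proof (rule emeasure_measure_of_sigma)
  show "sigma_algebra UNIV (sets (borel :: 'a measure))"
    using sets.sigma_algebra_axioms[of "borel :: 'a measure"] by simp
  have sums: "(\<lambda>i. \<mu> (A i)) sums \<mu> (\<Union>i. A i)"
    if "range A \<subseteq> sets borel" "disjoint_family A" for A :: "nat \<Rightarrow> 'a set"
    using M_posD(3)[OF assms(1)] that by (auto simp: M_space_def complex_borel_measure_def)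
  have "(\<lambda>i::nat. \<mu> {}) sums \<mu> {}"
    using sums[of "\<lambda>i. {}"] by (simp add: disjoint_family_on_def)
  then have "\<mu> {} = 0"
    using sums_summable summable_const_iff by blast
  then show "positive (sets borel) (\<lambda>E. ennreal (Re (\<mu> E)))"
    by (simp add: positive_def)
  show "countably_additive (sets borel) (\<lambda>E. ennreal (Re (\<mu> E)))"
    unfolding countably_additive_def
  proof (intro allI impI)
    fix A :: "nat \<Rightarrow> 'a set"
    assume A: "range A \<subseteq> sets borel" "disjoint_family A"
    show "(\<Sum>i. ennreal (Re (\<mu> (A i)))) = ennreal (Re (\<mu> (\<Union> (range A))))"
      using sums_Re[OF sums[OF A]] M_posD(1)[OF assms(1)]
      by (intro suminf_ennreal_eq) auto
  qed
qed (use assms in auto)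

lemma measure_to_measure:
  assumes "\<mu> \<in> M_pos" "E \<in> sets borel"
  shows "measure (to_measure \<mu>) E = Re (\<mu> E)"
  using assms by (simp add: measure_def emeasure_to_measure M_posD)

lemma finite_measure_to_measure:
  assumes "\<mu> \<in> M_pos"
  shows "finite_measure (to_measure \<mu>)"
  by (rule finite_measureI) (use assms in \<open>simp add: emeasure_to_measure\<close>)

text \<open>
  Regularity applied to the whole space: the open set around it must be the whole space as well.
\<close>

lemma tight_to_measure:
  fixes \<mu> :: "'a::t2_space set_function"
  assumes "\<mu> \<in> M_pos" "\<epsilon> > 0"
  obtains C where "compact C" "measure (to_measure \<mu>) (UNIV - C) < \<epsilon>"
proof -
  have "regular_measure \<mu>"
    using M_posD(3)[OF assms(1)] by (simp add: M_space_def)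
  then obtain C U where C: "compact C" and U: "UNIV \<subseteq> U" "total_variation \<mu> (U - C) < ennreal \<epsilon>"
    unfolding regular_measure_def using assms(2) sets.top[of borel] by (metis space_borel)
  have sets: "UNIV - C \<in> sets borel"
    using C by (intro sets.Diff) (auto simp: borel_compact)
  have "U = UNIV"
    using U(1) by auto
  then have "ennreal (norm (\<mu> (UNIV - C))) < ennreal \<epsilon>"
    using norm_le_total_variation[OF sets, of \<mu>] U(2) by (simp add: order_le_less_trans)
  then have "norm (\<mu> (UNIV - C)) < \<epsilon>"
    by (simp add: ennreal_less_iff)
  then have "measure (to_measure \<mu>) (UNIV - C) < \<epsilon>"
    using measure_to_measure[OF assms(1) sets] complex_Re_le_cmod[of "\<mu> (UNIV - C)"] by simp
  with C that show ?thesis by blast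
qed

lemma integrable_bounded:
  fixes f :: "'a::topological_space \<Rightarrow> 'b::{banach, second_countable_topology}"
  assumes "sets M = sets borel" "finite_measure M" "f \<in> borel_measurable borel" "bounded (range f)"
  shows "integrable M f"
proof -
  obtain B where "\<And>x. norm (f x) \<le> B"
    using assms(4) by (auto simp: bounded_iff)
  then show ?thesis
    using assms(1,3) by (intro finite_measure.integrable_const_bound[OF assms(2), of _ B])
      (auto simp: measurable_cong_sets[OF assms(1) refl])
qed

lemmas integrable_to_measure =
  integrable_bounded[OF sets_to_measure finite_measure_to_measure]

section \<open>Simultaneous Riemann sums\<close>

text \<open>
  A partition fine enough for finitely many functions at once, presented by the map \<open>r\<close> that sends
  each point to a chosen representative of its piece. Two points share a piece if all values
  \<open>g x / \<delta>\<close> have the same integer part; boundedness leaves finitely many pieces. The map \<open>r\<close> refers to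
  no measure, so Riemann sums formed with it can be compared between different measures.
\<close>

lemma finite_range_approximation:
  fixes F :: "('a::topological_space \<Rightarrow> real) set"
  assumes "finite F" and "\<delta> > 0"
    and F: "\<And>g. g \<in> F \<Longrightarrow> g \<in> borel_measurable borel" "\<And>g. g \<in> F \<Longrightarrow> bounded (range g)"
  obtains r :: "'a \<Rightarrow> 'a" where "finite (range r)" "\<And>a. r -` {a} \<in> sets borel"
    "\<And>g x. g \<in> F \<Longrightarrow> \<bar>g x - g (r x)\<bar> \<le> \<delta>"
proof -
  define key where "key x = (\<lambda>g\<in>F. \<lfloor>g x / \<delta>\<rfloor>)" for x
  define r where "r x = inv_into UNIV key (key x)" for x
  have key_r: "key (r x) = key x" for x
    by (simp add: r_def f_inv_into_f)
  have "finite (range (\<lambda>x. \<lfloor>g x / \<delta>\<rfloor>))" if "g \<in> F" for g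
  proof -
    obtain B where B: "\<bar>g x\<bar> \<le> B" for x
      using F(2)[OF \<open>g \<in> F\<close>] by (auto simp: bounded_iff)
    have "-B \<le> g x" "g x \<le> B" for x
      using B[of x] by linarith+
    then have "-B / \<delta> \<le> g x / \<delta>" "g x / \<delta> \<le> B / \<delta>" for x
      using \<open>\<delta> > 0\<close> by (blast intro: divide_right_mono less_imp_le)+
    then have "range (\<lambda>x. \<lfloor>g x / \<delta>\<rfloor>) \<subseteq> {\<lfloor>-B / \<delta>\<rfloor>..\<lfloor>B / \<delta>\<rfloor>}"
      unfolding image_subset_iff atLeastAtMost_iff using floor_mono by blast
    then show ?thesis
      using finite_subset by blast
  qed
  then have "finite (Pi\<^sub>E F (\<lambda>g. range (\<lambda>x. \<lfloor>g x / \<delta>\<rfloor>)))"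
    using \<open>finite F\<close> by (intro finite_PiE) auto
  then have "finite (range key)"
    by (rule rev_finite_subset) (auto simp: key_def)
  then have "finite (inv_into UNIV key ` range key)"
    by simp
  then have fin: "finite (range r)"
    by (simp add: r_def image_image)
  have fib: "r -` {a} \<in> sets borel" for a
  \<comment> \<open>A point that does not represent its own piece has an empty fibre.\<close>
  proof (cases "r a = a")
    case True
    have "{x \<in> space borel. \<forall>g\<in>F. real_of_int \<lfloor>g a / \<delta>\<rfloor> \<le> g x / \<delta> \<and> g x / \<delta> < real_of_int \<lfloor>g a / \<delta>\<rfloor> + 1}
        \<in> sets borel" (is "?S \<in> _")
    proof (rule sets.sets_Collect_finite_All[OF _ \<open>finite F\<close>])
      fix g assume "g \<in> F"
      have [measurable]: "g \<in> borel_measurable borel"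
        using F(1)[OF \<open>g \<in> F\<close>] .
      show "{x \<in> space borel. real_of_int \<lfloor>g a / \<delta>\<rfloor> \<le> g x / \<delta> \<and> g x / \<delta> < real_of_int \<lfloor>g a / \<delta>\<rfloor> + 1}
          \<in> sets borel"
        by measurable
    qed
    moreover have "r x = a \<longleftrightarrow> (\<forall>g\<in>F. \<lfloor>g x / \<delta>\<rfloor> = \<lfloor>g a / \<delta>\<rfloor>)" for x
    proof
      assume "r x = a"
      then have "key x = key a" using key_r by metis
      then show "\<forall>g\<in>F. \<lfloor>g x / \<delta>\<rfloor> = \<lfloor>g a / \<delta>\<rfloor>"
        by (simp add: key_def fun_eq_iff restrict_apply) metis
    next
      assume "\<forall>g\<in>F. \<lfloor>g x / \<delta>\<rfloor> = \<lfloor>g a / \<delta>\<rfloor>"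
      then have "key x = key a" by (auto simp: key_def)
      then show "r x = a" using True by (simp add: r_def)
    qed
    then have "r -` {a} = ?S"
      by (auto simp: floor_eq_iff)
    ultimately show ?thesis by simp
  next
    case False
    have "r x \<noteq> a" for x
      using False key_r[of x] by (auto simp: r_def)
    then have "r -` {a} = {}" by auto
    then show ?thesis by simp
  qed
  have "\<bar>g x - g (r x)\<bar> \<le> \<delta>" if "g \<in> F" for g x
  proof -
    have "\<lfloor>g x / \<delta>\<rfloor> = \<lfloor>g (r x) / \<delta>\<rfloor>"
      using key_r[of x] that by (simp add: key_def fun_eq_iff restrict_apply) metis
    then have "\<bar>g x / \<delta> - g (r x) / \<delta>\<bar> \<le> 1"
      by linarith
    then show ?thesis
      using \<open>\<delta> > 0\<close> by (simp add: abs_le_iff field_simps)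
  qed
  with fin fib that show ?thesis by blast
qed

lemma riemann_sum_error:
  fixes g :: "'a::topological_space \<Rightarrow> real"
  assumes M: "sets M = sets borel" "finite_measure M"
    and g: "g \<in> borel_measurable borel" "bounded (range g)"
    and r: "finite (range r)" "\<And>a. r -` {a} \<in> sets borel"
      "\<And>x. \<bar>g x - g (r x)\<bar> \<le> \<delta>"
  shows "\<bar>integral\<^sup>L M g - (\<Sum>a\<in>range r. g a * measure M (r -` {a}))\<bar> \<le> \<delta> * measure M UNIV"
proof -
  interpret finite_measure M by fact
  have [simp]: "space M = UNIV"
    using sets_eq_imp_space_eq[OF M(1)] by simp
  have gM: "integrable M g"
    by (rule integrable_bounded[OF M g])
  have gr: "g (r x) = (\<Sum>a\<in>range r. g a * indicat_real (r -` {a}) x)" for x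
  proof -
    have "(\<Sum>a\<in>range r. g a * indicat_real (r -` {a}) x) = (\<Sum>a\<in>range r. if a = r x then g a else 0)"
      by (rule sum.cong) (auto simp: indicator_def)
    then show ?thesis
      using r(1) by (simp add: sum.delta)
  qed
  have int: "integrable M (\<lambda>x. g a * indicat_real (r -` {a}) x)" for a
    using r(2)[of a] M(1) by (intro integrable_mult_right) (simp add: emeasure_eq_measure)
  have igr: "integrable M (\<lambda>x. g (r x))"
    unfolding gr by (rule Bochner_Integration.integrable_sum[OF int])
  have "integral\<^sup>L M (\<lambda>x. g (r x)) = (\<Sum>a\<in>range r. integral\<^sup>L M (\<lambda>x. g a * indicat_real (r -` {a}) x))"
    unfolding gr by (rule Bochner_Integration.integral_sum[OF int])
  also have "\<dots> = (\<Sum>a\<in>range r. g a * measure M (r -` {a}))"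
    using r(2) M(1) by simp
  finally have eq: "(\<Sum>a\<in>range r. g a * measure M (r -` {a})) = integral\<^sup>L M (\<lambda>x. g (r x))" ..
  have "\<bar>integral\<^sup>L M g - integral\<^sup>L M (\<lambda>x. g (r x))\<bar> = \<bar>integral\<^sup>L M (\<lambda>x. g x - g (r x))\<bar>"
    using gM igr by simp
  also have "\<dots> \<le> integral\<^sup>L M (\<lambda>x. \<bar>g x - g (r x)\<bar>)"
    using integral_norm_bound[of M "\<lambda>x. g x - g (r x)"] by simp
  also have "\<dots> \<le> integral\<^sup>L M (\<lambda>x. \<delta>)"
    using gM igr r(3) by (intro integral_mono) auto
  also have "\<dots> = \<delta> * measure M UNIV"
    by simp
  finally show ?thesis
    by (simp add: eq)
qed

lemma eq_zero_if_le_all_multiples: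
  fixes d C :: real
  assumes "\<And>\<delta>. \<delta> > 0 \<Longrightarrow> \<bar>d\<bar> \<le> \<delta> * C"
  shows "d = 0"
proof (rule ccontr)
  assume "d \<noteq> 0"
  have "C > 0"
    using assms[of 1] \<open>d \<noteq> 0\<close> by simp
  then show False
    using assms[of "\<bar>d\<bar> / (2 * C)"] \<open>d \<noteq> 0\<close> by (simp add: field_simps)
qed

text \<open>
  Linearity of the integral in the measure. With one map \<open>r\<close> for all measures involved, Riemann sums
  are linear in the measure by inspection, and the errors of all of them tend to \<open>0\<close> with \<open>\<delta>\<close>.
\<close>

lemma integral_to_measure_sum:
  fixes f :: "'a::topological_space \<Rightarrow> real"
  assumes "finite X" and c: "\<And>x. x \<in> X \<Longrightarrow> c x \<ge> 0" and \<mu>: "\<And>x. x \<in> X \<Longrightarrow> \<mu> x \<in> M_pos"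
    and \<nu>: "\<nu> \<in> M_pos" "\<And>E. \<nu> E = (\<Sum>x\<in>X. complex_of_real (c x) * \<mu> x E)"
    and f: "f \<in> borel_measurable borel" "bounded (range f)"
  shows "integral\<^sup>L (to_measure \<nu>) f = (\<Sum>x\<in>X. c x * integral\<^sup>L (to_measure (\<mu> x)) f)"
proof -
  let ?m = "\<lambda>x. measure (to_measure (\<mu> x))"
  let ?C = "measure (to_measure \<nu>) UNIV + (\<Sum>x\<in>X. c x * ?m x UNIV)"
  have m\<nu>: "measure (to_measure \<nu>) E = (\<Sum>x\<in>X. c x * ?m x E)" if "E \<in> sets borel" for E
    using that \<mu> by (simp add: measure_to_measure \<nu>)
  have "\<bar>integral\<^sup>L (to_measure \<nu>) f - (\<Sum>x\<in>X. c x * integral\<^sup>L (to_measure (\<mu> x)) f)\<bar> \<le> \<delta> * ?C"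
    if \<delta>: "\<delta> > 0" for \<delta>
  proof -
    obtain r :: "'a \<Rightarrow> 'a" where r: "finite (range r)" "\<And>a. r -` {a} \<in> sets borel"
      "\<And>x. \<bar>f x - f (r x)\<bar> \<le> \<delta>"
      by (rule finite_range_approximation[of "{f}" \<delta>]) (use \<delta> f in auto)
    define R where "R M = (\<Sum>a\<in>range r. f a * measure M (r -` {a}))" for M
    have err: "\<bar>integral\<^sup>L (to_measure \<rho>) f - R (to_measure \<rho>)\<bar> \<le> \<delta> * measure (to_measure \<rho>) UNIV"
      if "\<rho> \<in> M_pos" for \<rho>
      unfolding R_def
      by (rule riemann_sum_error[OF sets_to_measure finite_measure_to_measure[OF that] f r])
    have R\<nu>: "R (to_measure \<nu>) = (\<Sum>x\<in>X. c x * R (to_measure (\<mu> x)))"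
      unfolding R_def m\<nu>[OF r(2)] sum_distrib_left
      by (subst sum.swap) (simp add: mult_ac)
    have "\<bar>\<Sum>x\<in>X. c x * integral\<^sup>L (to_measure (\<mu> x)) f - c x * R (to_measure (\<mu> x))\<bar>
        \<le> (\<Sum>x\<in>X. \<delta> * (c x * ?m x UNIV))"
    proof (rule order_trans[OF sum_abs sum_mono])
      fix x assume x: "x \<in> X"
      show "\<bar>c x * integral\<^sup>L (to_measure (\<mu> x)) f - c x * R (to_measure (\<mu> x))\<bar> \<le> \<delta> * (c x * ?m x UNIV)"
        using mult_left_mono[OF err[OF \<mu>[OF x]] c[OF x]] c[OF x]
        by (simp add: abs_mult mult_ac flip: right_diff_distrib)
    qed
    then show ?thesis
      using err[OF \<nu>(1)] by (simp add: R\<nu> sum_subtractf sum_distrib_left distrib_left)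
  qed
  then show ?thesis
    using eq_zero_if_le_all_multiples[of _ ?C] eq_iff_diff_eq_0 by blast
qed

section \<open>Integration as a continuous function of the measure\<close>

lemma topspace_cone_topology [simp]: "topspace cone_topology = M_pos"
proof -
  let ?\<S> = "{{\<mu> \<in> M_pos. integral\<^sup>L (to_measure \<mu>) f \<in> V} | f V. f \<in> Cc_pos \<union> {\<lambda>x. 1} \<and> open V}"
  have "{\<mu> \<in> M_pos. integral\<^sup>L (to_measure \<mu>) (\<lambda>x. 1) \<in> UNIV} \<in> ?\<S>"
    by blast
  then have "M_pos \<subseteq> \<Union> ?\<S>"
    by blast
  moreover have "\<Union> ?\<S> \<subseteq> M_pos"
    by blast
  ultimately show ?thesis
    unfolding cone_topology_def topology_generated_by_topspace by (rule equalityI[rotated])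
qed

lemma continuous_map_integral_basic:
  assumes "f \<in> Cc_pos \<union> {\<lambda>x. 1}"
  shows "continuous_map cone_topology euclideanreal (\<lambda>\<mu>. integral\<^sup>L (to_measure \<mu>) f)"
proof -
  have "openin cone_topology {\<mu> \<in> M_pos. integral\<^sup>L (to_measure \<mu>) f \<in> V}" if "open V" for V
    unfolding cone_topology_def using assms that by (intro topology_generated_by_Basis) blast
  then show ?thesis
    by (simp add: continuous_map_def)
qed

lemma Hausdorff_space_euclidean_t2: "Hausdorff_space (euclidean :: 'a::t2_space topology)"
  unfolding Hausdorff_space_def disjnt_def by (metis hausdorff open_openin)

lemma compact_closure_subset: "compact L \<Longrightarrow> closure S \<subseteq> L \<Longrightarrow> compact (closure S)"
  by (metis closed_closure compact_Int_closed inf.absorb_iff2)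

text \<open>
  Complete regularity of a locally compact Hausdorff space separates \<open>C\<close> from the complement of a
  relatively compact neighbourhood of \<open>C\<close>.
\<close>

lemma compact_cutoff:
  fixes C :: "'a::t2_space set"
  assumes "locally_compact_space (euclidean :: 'a topology)" "compact C"
  obtains g :: "'a \<Rightarrow> real" where "continuous_on UNIV g" "\<And>x. 0 \<le> g x" "\<And>x. g x \<le> 1"
    "\<And>x. x \<in> C \<Longrightarrow> g x = 1" "compact (closure {x. g x \<noteq> 0})"
proof -
  obtain U L where UL: "open U" "compact L" "C \<subseteq> U" "U \<subseteq> L"
    using assms locally_compact_space_compact_closed_compact[of "euclidean :: 'a topology"]
      Hausdorff_space_euclidean_t2 by (metis compactin_euclidean_iff open_openin)
  have "completely_regular_space (euclidean :: 'a topology)"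
    using assms(1) Hausdorff_space_euclidean_t2 locally_compact_regular_imp_completely_regular_space
    by blast
  moreover have "closedin euclidean (- U)" "disjnt C (- U)"
    using UL by (auto simp: disjnt_def)
  ultimately obtain g :: "'a \<Rightarrow> real" where g: "continuous_map euclidean (top_of_set {0..1}) g"
      "g ` (- U) \<subseteq> {0}" "g ` C \<subseteq> {1}"
    using Urysohn_completely_regular_compact_closed[of 0 1 "euclidean :: 'a topology" C "- U"]
      assms(2) by auto
  have "closure {x. g x \<noteq> 0} \<subseteq> L"
    using g(2) UL by (intro closure_minimal) (auto simp: compact_imp_closed)
  then have "compact (closure {x. g x \<noteq> 0})"
    using UL(2) by (rule compact_closure_subset[rotated])
  moreover have "continuous_on UNIV g" "\<And>x. 0 \<le> g x" "\<And>x. g x \<le> 1"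
    using g(1) by (auto simp: continuous_map_in_subtopology Pi_iff)
  ultimately show ?thesis
    using that g(3) by blast
qed

lemma borel_measurable_if_continuous:
  fixes f :: "'a::topological_space \<Rightarrow> 'b::topological_space"
  shows "continuous_on UNIV f \<Longrightarrow> f \<in> borel_measurable borel"
  by (rule borel_measurable_continuous_onI)

text \<open>
  Let \<open>g\<close> be a cutoff for a compact set that carries \<open>\<mu>\<close> up to \<open>\<delta>\<close>. The product \<open>f * g\<close> has compact
  support, so its integral is continuous by definition of the topology. The error made by replacing
  \<open>f\<close> by \<open>f * g\<close> is at most \<open>B\<close> times the integral of \<open>1 - g\<close>, which is itself
  continuous in the measure and below \<open>\<delta>\<close> at \<open>\<mu>\<close>, hence below \<open>\<delta>\<close> in a neighbourhood of \<open>\<mu>\<close>.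
\<close>

lemma continuous_map_integral_nonneg:
  fixes f :: "'a::t2_space \<Rightarrow> real"
  assumes lc: "locally_compact_space (euclidean :: 'a topology)"
    and f: "continuous_on UNIV f" "\<And>x. 0 \<le> f x" "\<And>x. f x \<le> B"
  shows "continuous_map cone_topology euclideanreal (\<lambda>\<mu>. integral\<^sup>L (to_measure \<mu>) f)"
proof -
  let ?I = "\<lambda>f \<mu>. integral\<^sup>L (to_measure \<mu>) f"
  have B: "B \<ge> 0"
    using f(2,3) order_trans by blast
  have "\<exists>U. openin cone_topology U \<and> \<mu> \<in> U \<and> (\<forall>\<nu>\<in>U. ?I f \<nu> \<in> ball (?I f \<mu>) \<epsilon>)"
    if \<mu>: "\<mu> \<in> M_pos" and \<epsilon>: "\<epsilon> > 0" for \<mu> \<epsilon>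
  proof -
    \<comment> \<open>\<open>B + 1\<close> instead of \<open>B\<close> only avoids a division by zero when \<open>B = 0\<close>.\<close>
    define \<delta> where "\<delta> = \<epsilon> / (2 * (B + 1))"
    have \<delta>: "\<delta> > 0" "B * \<delta> \<le> \<epsilon> / 2"
      using B \<epsilon> by (auto simp: \<delta>_def field_simps)
    obtain C where C: "compact C" "measure (to_measure \<mu>) (UNIV - C) < \<delta>"
      using tight_to_measure[OF \<mu> \<delta>(1)] .
    obtain g :: "'a \<Rightarrow> real" where g: "continuous_on UNIV g" "\<And>x. 0 \<le> g x" "\<And>x. g x \<le> 1"
      "\<And>x. x \<in> C \<Longrightarrow> g x = 1" "compact (closure {x. g x \<noteq> 0})"
      using compact_cutoff[OF lc C(1)] by blast
    have "closure {x. f x * g x \<noteq> 0} \<subseteq> closure {x. g x \<noteq> 0}"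
      by (intro closure_mono) auto
    then have "compact (closure {x. f x * g x \<noteq> 0})"
      by (rule compact_closure_subset[OF g(5)])
    then have fg: "(\<lambda>x. f x * g x) \<in> Cc_pos"
      using f g by (auto simp: Cc_pos_def intro!: continuous_on_mult)
    have gC: "g \<in> Cc_pos"
      using g by (auto simp: Cc_pos_def)
    have [measurable]: "f \<in> borel_measurable borel" "g \<in> borel_measurable borel"
      using f(1) g(1) by (auto intro: borel_measurable_if_continuous)
    have fg_le: "f x * g x \<le> B" for x
      using mult_left_le[OF g(3)[of x] f(2)[of x]] f(3)[of x] by simp
    have "bounded (range f)"
      by (rule boundedI[of _ B]) (use f in auto)
    moreover have "bounded (range g)"
      by (rule boundedI[of _ 1]) (use g in auto)
    moreover have "bounded (range (\<lambda>x. f x * g x))"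
      by (rule boundedI[of _ B]) (use f g fg_le in auto)
    ultimately have bdd: "bounded (range f)" "bounded (range g)" "bounded (range (\<lambda>x. f x * g x))" .
    have tail: "0 \<le> ?I f \<nu> - ?I (\<lambda>x. f x * g x) \<nu>"
      "?I f \<nu> - ?I (\<lambda>x. f x * g x) \<nu> \<le> B * (?I (\<lambda>x. 1) \<nu> - ?I g \<nu>)" if \<nu>: "\<nu> \<in> M_pos" for \<nu>
    proof -
      note int = integrable_to_measure[OF \<nu>]
      have i: "integrable (to_measure \<nu>) f" "integrable (to_measure \<nu>) g"
        "integrable (to_measure \<nu>) (\<lambda>x. f x * g x)" "integrable (to_measure \<nu>) (\<lambda>x. 1 :: real)"
        using bdd by (auto intro!: int)
      have eq: "?I f \<nu> - ?I (\<lambda>x. f x * g x) \<nu> = ?I (\<lambda>x. f x * (1 - g x)) \<nu>"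
        using i by (simp add: right_diff_distrib)
      show "0 \<le> ?I f \<nu> - ?I (\<lambda>x. f x * g x) \<nu>"
        unfolding eq using f g by (intro integral_nonneg_AE) auto
      have "?I (\<lambda>x. f x * (1 - g x)) \<nu> \<le> ?I (\<lambda>x. B * (1 - g x)) \<nu>"
      proof (rule integral_mono)
        show "integrable (to_measure \<nu>) (\<lambda>x. f x * (1 - g x))"
          using Bochner_Integration.integrable_diff[OF i(1,3)] by (simp add: right_diff_distrib)
        show "integrable (to_measure \<nu>) (\<lambda>x. B * (1 - g x))"
          by (intro integrable_mult_right Bochner_Integration.integrable_diff i)
      qed (use f(3) g(3) in \<open>simp add: mult_right_mono\<close>)
      also have "\<dots> = B * (?I (\<lambda>x. 1) \<nu> - ?I g \<nu>)"
        using Bochner_Integration.integral_diff[OF i(4,2)] by simp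
      finally show "?I f \<nu> - ?I (\<lambda>x. f x * g x) \<nu> \<le> B * (?I (\<lambda>x. 1) \<nu> - ?I g \<nu>)"
        unfolding eq .
    qed
    define U where "U = {\<nu> \<in> topspace cone_topology. ?I (\<lambda>x. 1) \<nu> - ?I g \<nu> \<in> {..<\<delta>}} \<inter>
      {\<nu> \<in> topspace cone_topology. ?I (\<lambda>x. f x * g x) \<nu> \<in> ball (?I (\<lambda>x. f x * g x) \<mu>) (\<epsilon> / 2)}"
    have "openin cone_topology U"
      unfolding U_def using gC fg
      by (intro openin_Int openin_continuous_map_preimage[where Y = euclideanreal]
            continuous_map_diff continuous_map_integral_basic) (auto simp flip: open_openin)
    moreover have small: "?I (\<lambda>x. 1) \<mu> - ?I g \<mu> < \<delta>"
    proof -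
      have C': "UNIV - C \<in> sets borel"
        using C(1) by (intro sets.Diff) (auto simp: borel_compact)
      have "integrable (to_measure \<mu>) g" "integrable (to_measure \<mu>) (\<lambda>x. 1 :: real)"
        using bdd by (auto intro!: integrable_to_measure[OF \<mu>])
      moreover have ind: "integrable (to_measure \<mu>) (indicat_real (UNIV - C))"
        using C' by (intro integrable_to_measure[OF \<mu>] boundedI[of _ 1]) (auto simp: indicator_def)
      ultimately have "?I (\<lambda>x. 1) \<mu> - ?I g \<mu> = ?I (\<lambda>x. 1 - g x) \<mu>"
        and "integrable (to_measure \<mu>) (\<lambda>x. 1 - g x)"
        by simp_all
      moreover have "?I (\<lambda>x. 1 - g x) \<mu> \<le> ?I (indicat_real (UNIV - C)) \<mu>"
        using g(2,4) calculation(2) ind by (intro integral_mono) (auto simp: indicator_def)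
      ultimately show ?thesis
        using C(2) C' by simp
    qed
    then have "\<mu> \<in> U"
      using \<mu> \<epsilon> by (simp add: U_def)
    moreover have "?I f \<nu> \<in> ball (?I f \<mu>) \<epsilon>" if "\<nu> \<in> U" for \<nu>
    proof -
      have \<nu>: "\<nu> \<in> M_pos" "?I (\<lambda>x. 1) \<nu> - ?I g \<nu> < \<delta>"
        "\<bar>?I (\<lambda>x. f x * g x) \<mu> - ?I (\<lambda>x. f x * g x) \<nu>\<bar> < \<epsilon> / 2"
        using that by (auto simp: U_def dist_real_def)
      have "B * (?I (\<lambda>x. 1) \<nu> - ?I g \<nu>) \<le> \<epsilon> / 2" "B * (?I (\<lambda>x. 1) \<mu> - ?I g \<mu>) \<le> \<epsilon> / 2"
        using \<nu>(2) small B \<delta>(2) by (meson less_imp_le mult_left_mono order_trans)+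
      then show ?thesis
        using tail[OF \<nu>(1)] tail[OF \<mu>] \<nu>(3) unfolding mem_ball dist_real_def by linarith
    qed
    ultimately show ?thesis by blast
  qed
  then show ?thesis
    using Met_TC.continuous_map_to_metric[of cone_topology "?I f"] by simp
qed

text \<open>
  Adding a constant makes \<open>f\<close> nonnegative and changes the integral by a multiple of the total mass,
  which is one of the functions that define the topology.
\<close>

lemma continuous_map_integral:
  fixes f :: "'a::t2_space \<Rightarrow> real"
  assumes lc: "locally_compact_space (euclidean :: 'a topology)"
    and f: "continuous_on UNIV f" "bounded (range f)"
  shows "continuous_map cone_topology euclideanreal (\<lambda>\<mu>. integral\<^sup>L (to_measure \<mu>) f)"
proof -
  obtain B where B: "\<And>x. \<bar>f x\<bar> \<le> B"
    using f(2) by (auto simp: bounded_iff)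
  have f_le: "0 \<le> f x + B" "f x + B \<le> 2 * B" for x
    using B[of x] by linarith+
  have "continuous_map cone_topology euclideanreal
      (\<lambda>\<mu>. integral\<^sup>L (to_measure \<mu>) (\<lambda>x. f x + B) - B * integral\<^sup>L (to_measure \<mu>) (\<lambda>x. 1))"
    using f(1) f_le
    by (intro continuous_map_diff continuous_map_real_mult_left continuous_map_integral_basic
          continuous_map_integral_nonneg[OF lc, of _ "2 * B"] continuous_on_add continuous_on_const) auto
  then show ?thesis
  proof (rule continuous_map_eq)
    fix \<mu> :: "'a set_function"
    assume "\<mu> \<in> topspace cone_topology"
    then have \<mu>: "\<mu> \<in> M_pos" by simp
    have "integrable (to_measure \<mu>) f" "integrable (to_measure \<mu>) (\<lambda>x. B)"
      using f borel_measurable_if_continuous by (auto intro!: integrable_to_measure[OF \<mu>])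
    then show "integral\<^sup>L (to_measure \<mu>) (\<lambda>x. f x + B) - B * integral\<^sup>L (to_measure \<mu>) (\<lambda>x. 1)
        = integral\<^sup>L (to_measure \<mu>) f"
      by simp
  qed
qed

section \<open>Finitely supported measures are dense\<close>

definition atomic :: "'a::topological_space set \<Rightarrow> ('a \<Rightarrow> real) \<Rightarrow> 'a set_function" where
  "atomic X c = (\<lambda>E. \<Sum>x\<in>X. complex_of_real (c x) * point_mass x E)"

lemma point_mass_eq_atomic: "point_mass x = atomic {x} (\<lambda>_. 1)"
  by (simp add: atomic_def)

lemma point_mass_sums:
  assumes "range A \<subseteq> sets borel" "disjoint_family A"
  shows "(\<lambda>i::nat. point_mass x (A i)) sums point_mass x (\<Union>i. A i)"
proof (cases "\<exists>j. x \<in> A j")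
  case True
  then obtain j where j: "x \<in> A j" by blast
  have "x \<in> A i \<longleftrightarrow> i = j" for i
    using assms(2) j by (auto simp: disjoint_family_on_def)
  then have "(\<lambda>i. point_mass x (A i)) = (\<lambda>i. if i = j then 1 else 0)"
    using assms(1) by (auto simp: point_mass_def fun_eq_iff)
  moreover have "point_mass x (\<Union>i. A i) = 1"
    using assms(1) j by (auto simp: point_mass_def)
  ultimately show ?thesis
    using sums_single[of j "\<lambda>_. 1 :: complex"] by simp
qed (auto simp: point_mass_def)

text \<open>
  Regularity holds because the inner and the outer set can be chosen so that their
  difference misses the finite support altogether.
\<close>

lemma atomic_in_M_space:
  fixes X :: "'a::t1_space set"
  assumes "finite X"
  shows "atomic X c \<in> M_space"
  unfolding M_space_def
proof (intro CollectI conjI)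
  show "complex_borel_measure (atomic X c)"
    unfolding complex_borel_measure_def
  proof (intro conjI allI impI)
    fix A :: "nat \<Rightarrow> 'a set" assume "range A \<subseteq> sets borel" "disjoint_family A"
    then show "(\<lambda>i. atomic X c (A i)) sums atomic X c (\<Union> (range A))"
      unfolding atomic_def by (intro sums_sum sums_mult point_mass_sums)
  next
    fix E :: "'a set" assume "E \<notin> sets borel"
    then show "atomic X c E = 0" by (simp add: atomic_def point_mass_def)
  qed
  show "regular_measure (atomic X c)"
    unfolding regular_measure_def
  proof (intro ballI allI impI)
    fix E :: "'a set" and \<epsilon> :: real assume "\<epsilon> > 0"
    have zero: "atomic X c D = 0" if "D \<subseteq> - (X - E) - X \<inter> E" for D
      unfolding atomic_def using that by (intro sum.neutral) (auto simp: point_mass_def)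
    have "total_variation (atomic X c) (- (X - E) - X \<inter> E) \<le> 0"
      unfolding total_variation_def
    proof (rule SUP_least, clarify)
      fix A :: "nat \<Rightarrow> 'a set" assume "\<Union> (range A) = - (X - E) - X \<inter> E"
      then have "atomic X c (A i) = 0" for i
        by (intro zero) blast
      then show "(\<Sum>i. ennreal (norm (atomic X c (A i)))) \<le> 0" by simp
    qed
    then have "total_variation (atomic X c) (- (X - E) - X \<inter> E) < ennreal \<epsilon>"
      using \<open>\<epsilon> > 0\<close> by simp
    moreover have "compact (X \<inter> E)" "open (- (X - E))"
      using assms by (intro finite_imp_compact open_Compl finite_imp_closed; simp)+
    ultimately show "\<exists>C U. compact C \<and> open U \<and> C \<subseteq> E \<and> E \<subseteq> U
        \<and> total_variation (atomic X c) (U - C) < ennreal \<epsilon>"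
      by (intro exI[of _ "X \<inter> E"] exI[of _ "- (X - E)"]) auto
  qed
qed

lemma atomic_in_M_pos:
  fixes X :: "'a::t1_space set"
  assumes "finite X" "\<And>x. x \<in> X \<Longrightarrow> c x \<ge> 0"
  shows "atomic X c \<in> M_pos"
  using assms atomic_in_M_space[OF assms(1)]
  by (auto simp: M_pos_def complex_nonneg_Reals_iff atomic_def point_mass_def intro!: sum_nonneg)

lemma point_mass_in_M_pos [simp]: "point_mass (x :: 'a::t1_space) \<in> M_pos"
  unfolding point_mass_eq_atomic by (rule atomic_in_M_pos) auto

lemma point_mass_in_M_space [simp]: "point_mass (x :: 'a::t1_space) \<in> M_space"
  by (rule M_posD) simp

lemma integral_point_mass:
  fixes f :: "'a::t1_space \<Rightarrow> real"
  assumes "f \<in> borel_measurable borel"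
  shows "integral\<^sup>L (to_measure (point_mass x)) f = f x"
proof -
  let ?M = "to_measure (point_mass x)"
  have x: "{x} \<in> sets borel" by simp
  have "point_mass x (- {x}) = 0" "point_mass x UNIV = 1"
    by (auto simp: point_mass_def)
  then have "emeasure ?M (- {x}) = 0" and total: "measure ?M UNIV = 1"
    using x by (simp_all add: emeasure_to_measure measure_to_measure)
  then have "AE y in ?M. y = x"
    using x by (intro AE_I[of _ _ "- {x}"]) auto
  then have "integral\<^sup>L ?M f = integral\<^sup>L ?M (\<lambda>_. f x)"
    using assms by (intro integral_cong_AE) auto
  also have "\<dots> = f x"
    using total by simp
  finally show ?thesis .
qed

lemma integral_atomic:
  fixes f :: "'a::t1_space \<Rightarrow> real"
  assumes "finite X" "\<And>x. x \<in> X \<Longrightarrow> c x \<ge> 0" "f \<in> borel_measurable borel" "bounded (range f)"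
  shows "integral\<^sup>L (to_measure (atomic X c)) f = (\<Sum>x\<in>X. c x * f x)"
  using integral_to_measure_sum[of X c point_mass "atomic X c" f] assms
  by (simp add: atomic_in_M_pos integral_point_mass) (simp add: atomic_def)

text \<open>
  The sub-basis of the cone topology, put into the form of an \<open>\<epsilon>\<close>-neighbourhood base.
\<close>

lemma cone_topology_basic_neighbourhood:
  assumes "openin cone_topology U" "\<mu> \<in> U"
  obtains F \<epsilon> where "finite F" "F \<subseteq> Cc_pos \<union> {\<lambda>x. 1}" "\<epsilon> > 0"
    "\<And>\<nu>. \<nu> \<in> M_pos \<Longrightarrow>
      (\<And>g. g \<in> F \<Longrightarrow> \<bar>integral\<^sup>L (to_measure \<nu>) g - integral\<^sup>L (to_measure \<mu>) g\<bar> < \<epsilon>) \<Longrightarrow> \<nu> \<in> U"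
proof -
  let ?near = "\<lambda>F \<epsilon> \<nu>. \<forall>g\<in>F. \<bar>integral\<^sup>L (to_measure \<nu>) g - integral\<^sup>L (to_measure \<mu>) g\<bar> < \<epsilon>"
  let ?P = "\<lambda>U. \<exists>F \<epsilon>. finite F \<and> F \<subseteq> Cc_pos \<union> {\<lambda>x. 1} \<and> \<epsilon> > 0 \<and> (\<forall>\<nu>\<in>M_pos. ?near F \<epsilon> \<nu> \<longrightarrow> \<nu> \<in> U)"
  have "generate_topology_on
      {{\<mu> \<in> M_pos. integral\<^sup>L (to_measure \<mu>) f \<in> V} | f V. f \<in> Cc_pos \<union> {\<lambda>x. 1} \<and> open V} U"
    using assms(1) unfolding cone_topology_def by (rule openin_topology_generated_by)
  then have "?P U"
    using assms(2)
  proof induction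
    case Empty
    then show ?case by simp
  next
    case (Int A B)
    then obtain F \<epsilon> G \<delta> where "finite F" "F \<subseteq> Cc_pos \<union> {\<lambda>x. 1}" "\<epsilon> > 0" "\<forall>\<nu>\<in>M_pos. ?near F \<epsilon> \<nu> \<longrightarrow> \<nu> \<in> A"
      "finite G" "G \<subseteq> Cc_pos \<union> {\<lambda>x. 1}" "\<delta> > 0" "\<forall>\<nu>\<in>M_pos. ?near G \<delta> \<nu> \<longrightarrow> \<nu> \<in> B"
      by (metis (no_types, lifting) IntD1 IntD2)
    then show ?case
      by (intro exI[of _ "F \<union> G"] exI[of _ "min \<epsilon> \<delta>"]) auto
  next
    case (UN K)
    then obtain k where "k \<in> K" "\<mu> \<in> k" by blast
    from UN.IH[OF this] obtain F \<epsilon> where "finite F" "F \<subseteq> Cc_pos \<union> {\<lambda>x. 1}" "\<epsilon> > 0"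
      "\<forall>\<nu>\<in>M_pos. ?near F \<epsilon> \<nu> \<longrightarrow> \<nu> \<in> k" by blast
    with \<open>k \<in> K\<close> show ?case by blast
  next
    case (Basis S)
    then obtain f V where fV: "S = {\<mu> \<in> M_pos. integral\<^sup>L (to_measure \<mu>) f \<in> V}"
      "f \<in> Cc_pos \<union> {\<lambda>x. 1}" "open V" by blast
    then obtain \<epsilon> where "\<epsilon> > 0" "\<And>t. \<bar>t - integral\<^sup>L (to_measure \<mu>) f\<bar> < \<epsilon> \<Longrightarrow> t \<in> V"
      using Basis(2) by (auto simp: open_dist dist_real_def)
    then show ?case
      using fV by (intro exI[of _ "{f}"] exI[of _ \<epsilon>]) auto
  qed
  then obtain F \<epsilon> where F: "finite F" "F \<subseteq> Cc_pos \<union> {\<lambda>x. 1}" "\<epsilon> > 0"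
    and near: "\<forall>\<nu>\<in>M_pos. ?near F \<epsilon> \<nu> \<longrightarrow> \<nu> \<in> U"
    by (elim exE conjE)
  show ?thesis
    by (rule that[OF F]) (simp add: near)
qed

lemma Cc_pos_bounded:
  assumes "f \<in> Cc_pos"
  shows "bounded (range f)"
proof -
  have "compact (f ` closure {x. f x \<noteq> 0})"
    using assms by (intro compact_continuous_image) (auto simp: Cc_pos_def intro: continuous_on_subset)
  then have "bounded (insert 0 (f ` closure {x. f x \<noteq> 0}))"
    by (simp add: compact_imp_bounded)
  then show ?thesis
    by (rule bounded_subset) (use closure_subset in fastforce)
qed

text \<open>
  A Riemann sum of \<open>g\<close> for \<open>\<mu>\<close> is the integral of \<open>g\<close> against the measure that collects the mass
  of each piece of the partition in the representative of this piece. A basic neighbourhood tests only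
  finitely many functions, so a single partition serves all of them.
\<close>

lemma atomic_dense:
  fixes \<mu> :: "'a::t1_space set_function"
  assumes U: "openin cone_topology U" "\<mu> \<in> U"
  obtains X c where "finite X" "\<And>x. x \<in> X \<Longrightarrow> c x \<ge> 0" "atomic X c \<in> U"
proof -
  have \<mu>: "\<mu> \<in> M_pos"
    using openin_subset[OF U(1)] U(2) by auto
  obtain F \<epsilon> where F: "finite F" "F \<subseteq> Cc_pos \<union> {\<lambda>x. 1}" "\<epsilon> > 0"
    "\<And>\<nu>. \<nu> \<in> M_pos \<Longrightarrow>
      (\<And>g. g \<in> F \<Longrightarrow> \<bar>integral\<^sup>L (to_measure \<nu>) g - integral\<^sup>L (to_measure \<mu>) g\<bar> < \<epsilon>) \<Longrightarrow> \<nu> \<in> U"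
    using cone_topology_basic_neighbourhood[OF U] by blast
  have Fb: "g \<in> borel_measurable borel" "bounded (range g)" if gF: "g \<in> F" for g
  proof -
    have "continuous_on UNIV g" "bounded (range g)" if "g \<in> Cc_pos"
      using that Cc_pos_bounded by (auto simp: Cc_pos_def)
    moreover have "continuous_on UNIV g" "bounded (range g)" if "g \<notin> Cc_pos"
      using that gF F(2) by auto
    ultimately show "g \<in> borel_measurable borel" "bounded (range g)"
      by (blast intro: borel_measurable_if_continuous)+
  qed
  let ?m = "measure (to_measure \<mu>)"
  define \<delta> where "\<delta> = \<epsilon> / (?m UNIV + 1)"
  have m: "?m UNIV + 1 > 0"
    by (simp add: add_nonneg_pos)
  then have \<delta>: "\<delta> > 0" "\<delta> * ?m UNIV < \<epsilon>"
    using F(3) by (auto simp: \<delta>_def field_simps)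
  obtain r :: "'a \<Rightarrow> 'a" where r: "finite (range r)" "\<And>a. r -` {a} \<in> sets borel"
    "\<And>g x. g \<in> F \<Longrightarrow> \<bar>g x - g (r x)\<bar> \<le> \<delta>"
    using finite_range_approximation[OF F(1) \<delta>(1) Fb] by metis
  let ?\<nu> = "atomic (range r) (\<lambda>a. ?m (r -` {a}))"
  have "?\<nu> \<in> U"
  proof (rule F(4))
    show "?\<nu> \<in> M_pos"
      using r(1) by (rule atomic_in_M_pos) simp
    fix g assume g: "g \<in> F"
    have "integral\<^sup>L (to_measure ?\<nu>) g = (\<Sum>a\<in>range r. g a * ?m (r -` {a}))"
      using integral_atomic[OF r(1) _ Fb[OF g], of "\<lambda>a. ?m (r -` {a})"] by (simp add: mult.commute)
    moreover have "\<bar>integral\<^sup>L (to_measure \<mu>) g - (\<Sum>a\<in>range r. g a * ?m (r -` {a}))\<bar> \<le> \<delta> * ?m UNIV"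
      using riemann_sum_error[OF sets_to_measure finite_measure_to_measure[OF \<mu>] Fb[OF g] r(1,2) r(3)[OF g]] .
    ultimately show "\<bar>integral\<^sup>L (to_measure ?\<nu>) g - integral\<^sup>L (to_measure \<mu>) g\<bar> < \<epsilon>"
      using \<delta>(2) by (simp add: abs_minus_commute)
  qed
  with r(1) that show ?thesis by (metis measure_nonneg)
qed

section \<open>Translation of bounded continuous functions\<close>

lemma norm_integral_probability_le:
  fixes f :: "'a::topological_space \<Rightarrow> 'b::{banach, second_countable_topology}"
  assumes \<mu>: "\<mu> \<in> M_pos" "\<mu> UNIV = 1" and f: "continuous_on UNIV f" "\<And>x. norm (f x) \<le> B"
  shows "norm (integral\<^sup>L (to_measure \<mu>) f) \<le> B"
proof -
  have meas: "f \<in> borel_measurable borel" and bdd: "bounded (range f)"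
    using f by (auto intro: borel_measurable_if_continuous boundedI)
  have nf: "integrable (to_measure \<mu>) (\<lambda>x. norm (f x))"
    by (rule integrable_norm[OF integrable_to_measure[OF \<mu>(1) meas bdd]])
  have B: "integrable (to_measure \<mu>) (\<lambda>x. B)"
    by (auto intro!: integrable_to_measure[OF \<mu>(1)])
  have "norm (integral\<^sup>L (to_measure \<mu>) f) \<le> (\<integral>x. norm (f x) \<partial>to_measure \<mu>)"
    by (rule integral_norm_bound)
  also have "\<dots> \<le> (\<integral>x. B \<partial>to_measure \<mu>)"
    by (rule integral_mono[OF nf B]) (rule f(2))
  also have "\<dots> = B"
    using measure_to_measure[OF \<mu>(1), of UNIV] \<mu>(2) by simp
  finally show ?thesis .
qed

lemma bcontfun_integrable:
  fixes f :: "'a::topological_space \<Rightarrow>\<^sub>C complex"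
  assumes "\<mu> \<in> M_pos"
  shows "integrable (to_measure \<mu>) f"
  by (rule integrable_to_measure[OF assms]) (auto intro: borel_measurable_if_continuous)

lemma bcontfun_Re_Im:
  fixes f :: "'a::topological_space \<Rightarrow>\<^sub>C complex"
  shows "continuous_on UNIV (\<lambda>x. Re (f x))" "bounded (range (\<lambda>x. Re (f x)))"
    "continuous_on UNIV (\<lambda>x. Im (f x))" "bounded (range (\<lambda>x. Im (f x)))"
proof -
  have "\<bar>Re (f x)\<bar> \<le> norm f" "\<bar>Im (f x)\<bar> \<le> norm f" for x
    using norm_bounded[of f x] abs_Re_le_cmod[of "f x"] abs_Im_le_cmod[of "f x"] by linarith+
  then show "bounded (range (\<lambda>x. Re (f x)))" "bounded (range (\<lambda>x. Im (f x)))"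
    by (simp_all add: bounded_iff) blast+
qed (auto intro!: continuous_intros)

lemma Re_Im_integral_bcontfun:
  fixes f :: "'a::topological_space \<Rightarrow>\<^sub>C complex"
  assumes "\<mu> \<in> M_pos"
  shows "Re (integral\<^sup>L (to_measure \<mu>) f) = (\<integral>x. Re (f x) \<partial>to_measure \<mu>)"
    "Im (integral\<^sup>L (to_measure \<mu>) f) = (\<integral>x. Im (f x) \<partial>to_measure \<mu>)"
  using integral_bounded_linear[OF bounded_linear_Re bcontfun_integrable[OF assms, of f]]
    integral_bounded_linear[OF bounded_linear_Im bcontfun_integrable[OF assms, of f]] by simp_all

definition translation ::
  "('a::t2_space set_function \<Rightarrow> 'a set_function \<Rightarrow> 'a set_function) \<Rightarrow>
   'a \<Rightarrow> ('a \<Rightarrow>\<^sub>C complex) \<Rightarrow> ('a \<Rightarrow>\<^sub>C complex)" where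
  "translation conv x f = Bcontfun (left_translate conv x f)"

lemma continuous_map_point_mass:
  "continuous_map (euclidean :: 'a::t1_space topology) cone_topology point_mass"
  unfolding cone_topology_def continuous_on_generated_topo_iff
proof (intro conjI allI impI)
  fix U :: "'a set_function set"
  assume "U \<in> {{\<mu> \<in> M_pos. integral\<^sup>L (to_measure \<mu>) f \<in> V} | f V. f \<in> Cc_pos \<union> {\<lambda>x. 1} \<and> open V}"
  then obtain f V where U: "U = {\<mu> \<in> M_pos. integral\<^sup>L (to_measure \<mu>) f \<in> V}"
    and f: "f \<in> Cc_pos \<union> {\<lambda>x. 1}" and V: "open V" by blast
  have cont: "continuous_on UNIV f"
    using f by (auto simp: Cc_pos_def)
  then have "point_mass -` U = f -` V"
    unfolding U by (auto simp: integral_point_mass[OF borel_measurable_if_continuous])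
  moreover have "open (f -` V)"
    using V cont by (rule open_vimage)
  ultimately show "openin euclidean (point_mass -` U \<inter> topspace euclidean)"
    by (simp flip: open_openin)
next
  have "\<Union> {{\<mu> \<in> M_pos. integral\<^sup>L (to_measure \<mu>) f \<in> V} | f V. f \<in> Cc_pos \<union> {\<lambda>x. 1} \<and> open V}
      = (M_pos :: 'a set_function set)"
    using topspace_cone_topology unfolding cone_topology_def topology_generated_by_topspace .
  then show "point_mass ` topspace (euclidean :: 'a topology) \<subseteq>
      \<Union> {{\<mu> \<in> M_pos. integral\<^sup>L (to_measure \<mu>) f \<in> V} | f V. f \<in> Cc_pos \<union> {\<lambda>x. 1} \<and> open V}"
    using point_mass_in_M_pos by (simp add: image_subset_iff)
qed

context semihypergroup
begin

text \<open>
  The empty combination is the zero measure, which linearity with both coefficients \<open>0\<close> maps to zero.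
\<close>

lemma conv_atomic:
  assumes "\<rho> \<in> M_space" "finite X"
  shows "conv \<rho> (atomic X c) = (\<lambda>E. \<Sum>x\<in>X. complex_of_real (c x) * conv \<rho> (point_mass x) E)"
  using assms(2)
proof induction
  case empty
  show ?case
    using conv_linear_right[OF assms(1,1,1), of 0 0] by (simp add: atomic_def)
next
  case (insert x X)
  have "atomic (insert x X) c = (\<lambda>E. complex_of_real (c x) * point_mass x E + 1 * atomic X c E)"
    using insert.hyps by (simp add: atomic_def fun_eq_iff)
  then show ?case
    using conv_linear_right[OF point_mass_in_M_space atomic_in_M_space[OF insert.hyps(1)] assms(1),
        of "complex_of_real (c x)" x 1 c] insert by simp
qed

lemma continuous_map_conv:
  assumes "\<mu> \<in> M_pos" "continuous_map X cone_topology h"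
  shows "continuous_map X cone_topology (\<lambda>z. conv \<mu> (h z))"
proof -
  have "continuous_map X (prod_topology cone_topology cone_topology) (\<lambda>z. (\<mu>, h z))"
    using assms by (intro continuous_map_pairedI) auto
  from continuous_map_compose[OF this conv_continuous] show ?thesis
    by (simp add: o_def)
qed

lemma continuous_translate_real:
  fixes f :: "'a \<Rightarrow> real"
  assumes "continuous_on UNIV f" "bounded (range f)"
  shows "continuous_on UNIV (\<lambda>y. integral\<^sup>L (to_measure (conv (point_mass x) (point_mass y))) f)"
  using continuous_map_compose[OF continuous_map_conv[OF point_mass_in_M_pos[of x] continuous_map_point_mass]
      continuous_map_integral[OF locally_compact assms]]
  by (simp add: o_def)

lemma bounded_translate_real:
  fixes f :: "'a \<Rightarrow> real"
  assumes "continuous_on UNIV f" "bounded (range f)"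
  shows "bounded (range (\<lambda>y. integral\<^sup>L (to_measure (conv (point_mass x) (point_mass y))) f))"
proof -
  obtain B where B: "\<And>x. norm (f x) \<le> B"
    using assms(2) by (auto simp: bounded_iff)
  then have "norm (integral\<^sup>L (to_measure (conv (point_mass x) (point_mass y))) f) \<le> B" for y
    by (rule norm_integral_probability_le[OF conv_point_mass_prob assms(1)])
  then show ?thesis
    by (auto simp: bounded_iff)
qed

text \<open>
  The set of measures on which the two sides differ is open in the cone topology. If it contained
  \<open>\<mu>\<close> it would contain a finite combination of point masses, and for those the identity
  is linearity together with the definition of the translate.
\<close>

lemma integral_conv_real:
  fixes f :: "'a \<Rightarrow> real"
  assumes \<mu>: "\<mu> \<in> M_pos" and f: "continuous_on UNIV f" "bounded (range f)"
  shows "integral\<^sup>L (to_measure (conv (point_mass y) \<mu>)) f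
       = (\<integral>x. integral\<^sup>L (to_measure (conv (point_mass y) (point_mass x))) f \<partial>to_measure \<mu>)"
proof -
  let ?L = "\<lambda>x. integral\<^sup>L (to_measure (conv (point_mass y) (point_mass x))) f"
  define \<phi> where "\<phi> \<nu> = integral\<^sup>L (to_measure (conv (point_mass y) \<nu>)) f - integral\<^sup>L (to_measure \<nu>) ?L" for \<nu>
  have fm: "f \<in> borel_measurable borel"
    using f(1) by (rule borel_measurable_if_continuous)
  note L = continuous_translate_real[OF f, of y] bounded_translate_real[OF f, of y]
  have atomic: "\<phi> (atomic X c) = 0" if "finite X" "\<And>x. x \<in> X \<Longrightarrow> c x \<ge> 0" for X c
  proof -
    have pos: "conv (point_mass y) (atomic X c) \<in> M_pos"
      by (rule conv_pos[OF point_mass_in_M_pos atomic_in_M_pos[OF that]])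
    have "integral\<^sup>L (to_measure (conv (point_mass y) (atomic X c))) f = (\<Sum>x\<in>X. c x * ?L x)"
      by (rule integral_to_measure_sum[OF that _ pos _ fm f(2)])
        (simp_all add: conv_pos conv_atomic[OF point_mass_in_M_space that(1)])
    moreover have "integral\<^sup>L (to_measure (atomic X c)) ?L = (\<Sum>x\<in>X. c x * ?L x)"
      by (rule integral_atomic[OF that borel_measurable_if_continuous[OF L(1)] L(2)])
    ultimately show ?thesis
      by (simp add: \<phi>_def)
  qed
  have cont: "continuous_map cone_topology euclideanreal \<phi>"
    unfolding \<phi>_def
  proof (rule continuous_map_diff)
    show "continuous_map cone_topology euclideanreal (\<lambda>\<nu>. integral\<^sup>L (to_measure (conv (point_mass y) \<nu>)) f)"
      using continuous_map_compose[OF continuous_map_conv[OF point_mass_in_M_pos[of y] continuous_map_id]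
          continuous_map_integral[OF locally_compact f]] by (simp add: o_def)
    show "continuous_map cone_topology euclideanreal (\<lambda>\<nu>. integral\<^sup>L (to_measure \<nu>) ?L)"
      by (rule continuous_map_integral[OF locally_compact L])
  qed
  have "\<phi> \<mu> = 0"
  proof (rule ccontr)
    assume "\<phi> \<mu> \<noteq> 0"
    moreover have "openin cone_topology {\<nu> \<in> topspace cone_topology. \<phi> \<nu> \<in> - {0}}"
      by (rule openin_continuous_map_preimage[OF cont]) (simp add: open_Compl flip: open_openin)
    ultimately obtain X c where "finite X" "\<And>x. x \<in> X \<Longrightarrow> c x \<ge> 0"
        "atomic X c \<in> {\<nu> \<in> topspace cone_topology. \<phi> \<nu> \<in> - {0}}"
      using atomic_dense[of "{\<nu> \<in> topspace cone_topology. \<phi> \<nu> \<in> - {0}}" \<mu>] \<mu> by auto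
    with atomic show False by auto
  qed
  then show ?thesis
    by (simp add: \<phi>_def)
qed

lemma left_translate_in_bcontfun:
  fixes f :: "'a \<Rightarrow>\<^sub>C complex"
  shows "left_translate conv x f \<in> bcontfun"
proof -
  have "left_translate conv x f = (\<lambda>y. Complex
      (\<integral>z. Re (f z) \<partial>to_measure (conv (point_mass x) (point_mass y)))
      (\<integral>z. Im (f z) \<partial>to_measure (conv (point_mass x) (point_mass y))))"
    unfolding left_translate_def
    by (intro ext complex_eqI) (simp_all add: Re_Im_integral_bcontfun conv_point_mass_prob)
  then have "continuous_on UNIV (left_translate conv x f)"
    using bcontfun_Re_Im[of f] by (auto intro!: continuous_on_Complex continuous_translate_real)
  moreover have "norm (left_translate conv x f y) \<le> norm f" for y
    unfolding left_translate_def
    by (rule norm_integral_probability_le[OF conv_point_mass_prob]) (auto intro: norm_bounded)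
  ultimately show ?thesis
    by (auto simp: bcontfun_def intro: boundedI)
qed

lemma apply_translation:
  "apply_bcontfun (translation conv x f) y = integral\<^sup>L (to_measure (conv (point_mass x) (point_mass y))) f"
  using Bcontfun_inverse[OF left_translate_in_bcontfun, of x f]
  by (simp add: translation_def left_translate_def fun_eq_iff)

lemma norm_translation_le: "norm (translation conv x f) \<le> norm f"
  by (rule norm_bound)
    (auto simp: apply_translation norm_bounded intro!: norm_integral_probability_le conv_point_mass_prob)

lemma translation_add: "translation conv x (f + g) = translation conv x f + translation conv x g"
  by (rule bcontfun_eqI)
    (simp add: apply_translation bcontfun_integrable conv_point_mass_prob plus_bcontfun.rep_eq)

lemma translation_scaleC:
  "translation conv x (scaleC_bcontfun c f) = scaleC_bcontfun c (translation conv x f)"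
proof (rule bcontfun_eqI)
  have "apply_bcontfun (scaleC_bcontfun c f) = (\<lambda>z. c * f z)"
    by (simp add: fun_eq_iff)
  then show "translation conv x (scaleC_bcontfun c f) y = scaleC_bcontfun c (translation conv x f) y" for y
    by (simp add: apply_translation)
qed

lemma translation_const: "translation conv x (const_bcontfun c) = const_bcontfun c"
proof (rule bcontfun_eqI)
  fix y
  have "measure (to_measure (conv (point_mass x) (point_mass y))) UNIV = 1"
    by (simp add: measure_to_measure conv_point_mass_prob)
  then show "apply_bcontfun (translation conv x (const_bcontfun c)) y = const_bcontfun c y"
    by (simp add: apply_translation const_bcontfun.rep_eq)
qed

lemma integral_conv:
  fixes f :: "'a \<Rightarrow>\<^sub>C complex"
  assumes "\<mu> \<in> M_pos"
  shows "integral\<^sup>L (to_measure (conv (point_mass y) \<mu>)) f = integral\<^sup>L (to_measure \<mu>) (translation conv y f)"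
proof -
  have pos: "conv (point_mass y) \<mu> \<in> M_pos"
    by (rule conv_pos[OF point_mass_in_M_pos assms])
  show ?thesis
  proof (rule complex_eqI)
    show "Re (integral\<^sup>L (to_measure (conv (point_mass y) \<mu>)) f)
        = Re (integral\<^sup>L (to_measure \<mu>) (translation conv y f))"
      unfolding Re_Im_integral_bcontfun[OF pos] Re_Im_integral_bcontfun[OF assms]
        apply_translation Re_Im_integral_bcontfun[OF conv_point_mass_prob(1)]
      by (rule integral_conv_real[OF assms bcontfun_Re_Im(1,2)])
    show "Im (integral\<^sup>L (to_measure (conv (point_mass y) \<mu>)) f)
        = Im (integral\<^sup>L (to_measure \<mu>) (translation conv y f))"
      unfolding Re_Im_integral_bcontfun[OF pos] Re_Im_integral_bcontfun[OF assms]
        apply_translation Re_Im_integral_bcontfun[OF conv_point_mass_prob(1)]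
      by (rule integral_conv_real[OF assms bcontfun_Re_Im(3,4)])
  qed
qed

end

text \<open>
  At \<open>z\<close> the two sides are the integrals of \<open>f\<close> against \<open>p\<^sub>y * (p\<^sub>x * p\<^sub>z)\<close> and \<open>p\<^sub>x * (p\<^sub>y * p\<^sub>z)\<close>.
\<close>

lemma (in commutative_semihypergroup) translation_commute:
  "translation conv x (translation conv y f) = translation conv y (translation conv x f)"
proof (rule bcontfun_eqI)
  fix z
  let ?p = "point_mass :: 'a \<Rightarrow> 'a set_function"
  have "apply_bcontfun (translation conv x (translation conv y f)) z
      = integral\<^sup>L (to_measure (conv (?p y) (conv (?p x) (?p z)))) f"
    by (simp add: apply_translation integral_conv[OF conv_point_mass_prob(1)])
  also have "conv (?p y) (conv (?p x) (?p z)) = conv (?p x) (conv (?p y) (?p z))"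
    by (simp add: conv_commute[of "?p y" "?p x"] flip: conv_assoc)
  also have "integral\<^sup>L (to_measure (conv (?p x) (conv (?p y) (?p z)))) f
      = apply_bcontfun (translation conv y (translation conv x f)) z"
    by (simp add: apply_translation integral_conv[OF conv_point_mass_prob(1)])
  finally show "apply_bcontfun (translation conv x (translation conv y f)) z
      = apply_bcontfun (translation conv y (translation conv x f)) z" .
qed

section \<open>A Markov-Kakutani theorem for functionals\<close>

text \<open>
  Averaging over powers of \<open>T k\<close> makes the difference between \<open>m f\<close> and \<open>m (T k f)\<close> a telescoping sum
  divided by \<open>n\<close>. For the earlier operators, commutation turns the difference into an average of the old
  differences taken at \<open>(T k ^^ j) f\<close>, whose norm is at most that of \<open>f\<close>.
\<close>

lemma approximately_invariant_functional:
  fixes W :: "('v::real_normed_vector \<Rightarrow> complex) set" and T :: "'i \<Rightarrow> 'v \<Rightarrow> 'v"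
  assumes ne: "W \<noteq> {}" and bound: "\<And>m f. m \<in> W \<Longrightarrow> norm (m f) \<le> norm f"
    and average: "\<And>n m. \<lbrakk>0 < n; \<And>j. j < n \<Longrightarrow> m j \<in> W\<rbrakk> \<Longrightarrow> (\<lambda>f. (\<Sum>j<n. m j f) / of_nat n) \<in> W"
    and stable: "\<And>m i. m \<in> W \<Longrightarrow> (\<lambda>f. m (T i f)) \<in> W"
    and contraction: "\<And>i f. norm (T i f) \<le> norm f"
    and commute: "\<And>i j f. T i (T j f) = T j (T i f)"
    and "finite I" and n: "n > 0"
  shows "\<exists>m\<in>W. \<forall>i\<in>I. \<forall>f. norm (m f - m (T i f)) \<le> 2 * norm f / real n"
  using \<open>finite I\<close>
proof induction
  case empty
  then show ?case using ne by auto
next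
  case (insert k I)
  then obtain m where m: "m \<in> W" "\<And>i f. i \<in> I \<Longrightarrow> norm (m f - m (T i f)) \<le> 2 * norm f / real n"
    by blast
  have pow_stable: "(\<lambda>f. m ((T k ^^ j) f)) \<in> W" for j
  proof (induction j)
    case (Suc j)
    then show ?case
      using stable[OF Suc, of k] by (simp add: funpow_swap1)
  qed (use m in simp)
  have pow_contraction: "norm ((T k ^^ j) f) \<le> norm f" for j f
    by (induction j) (auto intro: order_trans[OF contraction])
  have pow_commute: "(T k ^^ j) (T i f) = T i ((T k ^^ j) f)" for i j f
    by (induction j) (auto simp: commute)
  define m' where "m' f = (\<Sum>j<n. m ((T k ^^ j) f)) / of_nat n" for f
  have "m' \<in> W"
    unfolding m'_def using average[OF n, of "\<lambda>j f. m ((T k ^^ j) f)"] pow_stable by simp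
  moreover have "norm (m' f - m' (T i f)) \<le> 2 * norm f / real n" if i: "i \<in> I" for i f
  proof -
    have "norm (m' f - m' (T i f))
        = norm (\<Sum>j<n. m ((T k ^^ j) f) - m (T i ((T k ^^ j) f))) / real n"
      by (simp add: m'_def pow_commute sum_subtractf norm_divide flip: diff_divide_distrib)
    also have "\<dots> \<le> (\<Sum>j<n. 2 * norm f / real n) / real n"
    proof (intro divide_right_mono order_trans[OF norm_sum sum_mono])
      fix j
      have "norm (m ((T k ^^ j) f) - m (T i ((T k ^^ j) f))) \<le> 2 * norm ((T k ^^ j) f) / real n"
        by (rule m(2)[OF i])
      also have "\<dots> \<le> 2 * norm f / real n"
        using pow_contraction by (intro divide_right_mono mult_left_mono) auto
      finally show "norm (m ((T k ^^ j) f) - m (T i ((T k ^^ j) f))) \<le> 2 * norm f / real n" .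
    qed simp
    also have "\<dots> = 2 * norm f / real n"
      using n by simp
    finally show ?thesis .
  qed
  moreover have "norm (m' f - m' (T k f)) \<le> 2 * norm f / real n" for f
  proof -
    have "norm (m' f - m' (T k f))
        = norm (\<Sum>j<n. m ((T k ^^ j) f) - m ((T k ^^ Suc j) f)) / real n"
      by (simp add: m'_def pow_commute sum_subtractf norm_divide flip: diff_divide_distrib)
    also have "(\<Sum>j<n. m ((T k ^^ j) f) - m ((T k ^^ Suc j) f)) = m f - m ((T k ^^ n) f)"
      using sum_lessThan_telescope'[of "\<lambda>j. m ((T k ^^ j) f)" n] by simp
    also have "norm \<dots> \<le> 2 * norm f"
      using norm_triangle_ineq4[of "m f" "m ((T k ^^ n) f)"] bound[OF m(1), of f]
        bound[OF m(1), of "(T k ^^ n) f"] pow_contraction[of n f] by linarith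
    finally show ?thesis
      by (simp add: divide_right_mono)
  qed
  ultimately show ?case by blast
qed

text \<open>
  The bound on the functionals places \<open>W\<close> as a closed subset in a product of discs, which is compact
  by Tychonoff's theorem. The sets of functionals invariant under \<open>T i\<close> up to an error of order
  \<open>1 / Suc n\<close> are closed, and every finite subfamily meets \<open>W\<close> by the preceding lemma. The
  conclusion is a fixed point of the maps \<open>m \<mapsto> m \<circ> T i\<close>.
\<close>

theorem Markov_Kakutani_functionals:
  fixes W :: "('v::real_normed_vector \<Rightarrow> complex) set" and T :: "'i \<Rightarrow> 'v \<Rightarrow> 'v"
  assumes ne: "W \<noteq> {}" and closed: "closed W"
    and bound: "\<And>m f. m \<in> W \<Longrightarrow> norm (m f) \<le> norm f"
    and average: "\<And>n m. \<lbrakk>0 < n; \<And>j. j < n \<Longrightarrow> m j \<in> W\<rbrakk> \<Longrightarrow> (\<lambda>f. (\<Sum>j<n. m j f) / of_nat n) \<in> W"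
    and stable: "\<And>m i. m \<in> W \<Longrightarrow> (\<lambda>f. m (T i f)) \<in> W"
    and contraction: "\<And>i f. norm (T i f) \<le> norm f"
    and commute: "\<And>i j f. T i (T j f) = T j (T i f)"
  shows "\<exists>m\<in>W. \<forall>i f. m (T i f) = m f"
proof -
  define A where "A = (\<lambda>(i, n). {m :: 'v \<Rightarrow> complex. \<forall>f. norm (m f - m (T i f)) \<le> 2 * norm f / real (Suc n)})"
  have "compactin (product_topology (\<lambda>f::'v. euclidean) UNIV) (Pi\<^sub>E UNIV (\<lambda>f. cball (0::complex) (norm f)))"
    unfolding compactin_PiE by simp
  then have "compact (Pi\<^sub>E UNIV (\<lambda>f::'v. cball (0::complex) (norm f)))"
    by (simp add: euclidean_product_topology)
  moreover have "W = Pi\<^sub>E UNIV (\<lambda>f. cball 0 (norm f)) \<inter> W"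
    using bound by auto
  ultimately have "compact W"
    using closed by (metis compact_Int_closed)
  then have "W \<inter> (\<Inter>p\<in>UNIV. A p) \<noteq> {}"
  proof (rule compact_imp_fip_image)
    fix p show "Topological_Spaces.closed (A p)"
      unfolding A_def case_prod_unfold
      by (intro closed_Collect_all closed_Collect_le continuous_intros continuous_on_product_coordinates)
  next
    fix P :: "('i \<times> nat) set" assume P: "finite P"
    \<comment> \<open>One accuracy that is good enough for all pairs in \<open>P\<close>; the \<open>0\<close> covers the empty \<open>P\<close>.\<close>
    define n where "n = Suc (Max (insert 0 (snd ` P)))"
    have "\<exists>m\<in>W. \<forall>i\<in>fst ` P. \<forall>f. norm (m f - m (T i f)) \<le> 2 * norm f / real n"
      by (rule approximately_invariant_functional)
        (fact ne bound average stable contraction commute | simp add: P n_def)+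
    then obtain m where m: "m \<in> W"
      "\<And>i f. i \<in> fst ` P \<Longrightarrow> norm (m f - m (T i f)) \<le> 2 * norm f / real n"
      by blast
    have "m \<in> A p" if "p \<in> P" for p
    proof -
      obtain i k where p: "p = (i, k)" by force
      have "Suc k \<le> n"
        using P that p by (auto simp: n_def intro!: Max_ge image_eqI[of k snd p])
      then have "2 * norm f / real n \<le> 2 * norm f / real (Suc k)" for f
        by (intro divide_left_mono) auto
      moreover have "norm (m f - m (T i f)) \<le> 2 * norm f / real n" for f
        using that p by (intro m(2)) force
      ultimately show ?thesis
        unfolding A_def p by (auto intro: order_trans)
    qed
    with m(1) show "W \<inter> (\<Inter>p\<in>P. A p) \<noteq> {}" by blast
  qed
  then obtain m where m: "m \<in> W" "\<And>p. m \<in> A p"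
    by blast
  have "m (T i f) = m f" for i f
  proof -
    have le: "norm (m f - m (T i f)) \<le> 2 * norm f / real (Suc n)" for n
      using m(2)[of "(i, n)"] by (auto simp: A_def)
    have "(\<lambda>n. 2 * norm f / real (Suc n)) \<longlonglongrightarrow> 0"
      using lim_const_over_n[of "2 * norm f"] by (rule LIMSEQ_Suc)
    then have "norm (m f - m (T i f)) \<le> 0"
      using le by (intro LIMSEQ_le_const) auto
    then show ?thesis by simp
  qed
  with m(1) show ?thesis by blast
qed

section \<open>Existence of an invariant mean\<close>

text \<open>
  In this form every condition is a pointwise closed condition on \<open>m\<close>, as compactness of the set of
  means requires. The operator norm cannot be smaller than \<open>1\<close> since \<open>m\<close> maps the constant \<open>1\<close>,
  a function of norm at most \<open>1\<close>, to \<open>1\<close>.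
\<close>

lemma is_mean_iff:
  "is_mean m \<longleftrightarrow> (\<forall>f g. m (f + g) = m f + m g) \<and> (\<forall>c f. m (scaleC_bcontfun c f) = c * m f) \<and>
     (\<forall>f. norm (m f) \<le> norm f) \<and> m (const_bcontfun 1) = 1"
proof
  assume m: "is_mean m"
  then have lin: "bounded_linear m"
    by (simp add: is_mean_def)
  have "m (f + g) = m f + m g" "norm (m f) \<le> norm f" for f g
    using m bounded_linear.axioms(1)[OF lin] onorm[OF lin, of f]
    by (simp_all add: is_mean_def linear_add)
  with m show "(\<forall>f g. m (f + g) = m f + m g) \<and> (\<forall>c f. m (scaleC_bcontfun c f) = c * m f) \<and>
      (\<forall>f. norm (m f) \<le> norm f) \<and> m (const_bcontfun 1) = 1"
    by (simp add: is_mean_def)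
next
  assume "(\<forall>f g. m (f + g) = m f + m g) \<and> (\<forall>c f. m (scaleC_bcontfun c f) = c * m f) \<and>
      (\<forall>f. norm (m f) \<le> norm f) \<and> m (const_bcontfun 1) = 1"
  then have m: "\<And>f g. m (f + g) = m f + m g" "\<And>c f. m (scaleC_bcontfun c f) = c * m f"
    "\<And>f. norm (m f) \<le> norm f" "m (const_bcontfun 1) = 1"
    by auto
  have scaleR: "r *\<^sub>R f = scaleC_bcontfun (complex_of_real r) f" for r and f :: "'a \<Rightarrow>\<^sub>C complex"
    by (rule bcontfun_eqI) (simp add: scaleR_conv_of_real)
  have lin: "bounded_linear m"
    by (rule bounded_linear_intro[where K = 1]) (simp_all add: m scaleR scaleR_conv_of_real)
  have "norm (const_bcontfun (1::complex) :: 'a \<Rightarrow>\<^sub>C complex) \<le> 1"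
    by (rule norm_bound) simp
  moreover have "norm (m (const_bcontfun 1)) \<le> onorm m * norm (const_bcontfun (1::complex) :: 'a \<Rightarrow>\<^sub>C complex)"
    by (rule onorm[OF lin])
  ultimately have "1 \<le> onorm m"
    using mult_left_le[OF _ onorm_pos_le[OF lin]] m(4) by fastforce
  moreover have "onorm m \<le> 1"
    by (rule onorm_bound) (simp_all add: m)
  ultimately show "is_mean m"
    using lin m by (simp add: is_mean_def)
qed

lemma evaluation_is_mean: "is_mean (\<lambda>f. apply_bcontfun f x)"
  by (simp add: is_mean_iff plus_bcontfun.rep_eq norm_bounded)

lemma closed_means: "closed {m :: ('a::topological_space \<Rightarrow>\<^sub>C complex) \<Rightarrow> complex. is_mean m}"
  unfolding is_mean_iff
  by (intro closed_Collect_conj closed_Collect_all closed_Collect_eq closed_Collect_le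
      continuous_intros continuous_on_product_coordinates)

lemma average_is_mean:
  assumes "n > 0" "\<And>j. j < n \<Longrightarrow> is_mean (m j)"
  shows "is_mean (\<lambda>f. (\<Sum>j<n. m j f) / of_nat n)"
  unfolding is_mean_iff
proof (intro conjI allI)
  note m = assms(2)[unfolded is_mean_iff]
  fix f g c
  show "(\<Sum>j<n. m j (f + g)) / of_nat n = (\<Sum>j<n. m j f) / of_nat n + (\<Sum>j<n. m j g) / of_nat n"
    using m by (simp add: sum.distrib flip: add_divide_distrib)
  show "(\<Sum>j<n. m j (scaleC_bcontfun c f)) / of_nat n = c * ((\<Sum>j<n. m j f) / of_nat n)"
    using m by (simp flip: sum_distrib_left)
  show "(\<Sum>j<n. m j (const_bcontfun 1)) / of_nat n = 1"
    using m assms(1) by simp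
  have "norm (\<Sum>j<n. m j f) \<le> (\<Sum>j<n. norm f)"
    using m by (intro order_trans[OF norm_sum sum_mono]) simp
  then show "norm ((\<Sum>j<n. m j f) / of_nat n) \<le> norm f"
    using assms(1) by (simp add: norm_divide field_simps)
qed

lemma (in semihypergroup) translation_stable_mean:
  assumes "is_mean m"
  shows "is_mean (\<lambda>f. m (translation conv x f))"
  using assms unfolding is_mean_iff
  by (auto simp: translation_add translation_scaleC translation_const intro: order_trans[OF _ norm_translation_le])

theorem theorem4p13:
  fixes conv :: "'a::t2_space set_function \<Rightarrow> 'a set_function \<Rightarrow> 'a set_function"
  assumes "commutative_semihypergroup conv"
  shows "\<exists>m :: ('a \<Rightarrow>\<^sub>C complex) \<Rightarrow> complex. left_invariant_mean conv m"
proof -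
  interpret commutative_semihypergroup conv by fact
  have "\<exists>m\<in>{m :: ('a \<Rightarrow>\<^sub>C complex) \<Rightarrow> complex. is_mean m}. \<forall>x f. m (translation conv x f) = m f"
  proof (rule Markov_Kakutani_functionals)
    show "{m :: ('a \<Rightarrow>\<^sub>C complex) \<Rightarrow> complex. is_mean m} \<noteq> {}"
      using evaluation_is_mean by blast
  next
    fix m :: "('a \<Rightarrow>\<^sub>C complex) \<Rightarrow> complex" and f :: "'a \<Rightarrow>\<^sub>C complex"
    assume "m \<in> {m. is_mean m}"
    then show "norm (m f) \<le> norm f" by (simp add: is_mean_iff)
  qed (auto simp: closed_means average_is_mean translation_stable_mean norm_translation_le
      intro: translation_commute)
  then show ?thesis
    unfolding left_invariant_mean_def using left_translate_in_bcontfun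
    by (auto simp: translation_def)
qed

end
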